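(* Let $a>0$, $\gamma\in[-1,+\infty)\setminus\{0\}$, $\underline{\rho}\ge 0$ (with $\underline{\rho}>0$ if $\gamma<1$), and let the pressure law be $$p(\rho)=\frac{a^2}{\gamma}\left(\rho^{\gamma}-\underline{\rho}^{\gamma}\right),\qquad \rho>\underline{\rho}.$$ Suppose that $(\mathbf v,p,\rho)$ is a self-similar solution of the two-dimensional isentropic Euler equations $$\partial_t\rho+\nabla_x\cdot(\rho\mathbf v)=0,\qquad \partial_t(\rho\mathbf v)+\nabla_x\cdot(\rho\,\mathbf v\otimes\mathbf v)+\nabla_x p=0,$$ that is, $\mathbf v,\rho$ depend only on $\xi=x/t\in\mathbb R^2$, $t>0$, and that the pseudo-velocity $U(\xi)=\mathbf v(\xi)-\xi$ is a $C^2$ function. Let $c^2=p'(\rho)>0$ be the squared sound speed and $h=h(\rho)$ the enthalpy. Then: 1. There exists $\mathcal F$ such that $c^2=\mathcal F(U)$, and the pseudo-velocity $U$ satisfies the system $$\begin{cases} c^2\,\mathrm{div}\,U-(DU)\,U\cdot U=|U|^2-2c^2,\\ \mathrm{div}(\omega U)+\omega=0,\end{cases}$$ where $\omega=\mathrm{rot}\,U=\partial_{\xi_1}U^2-\partial_{\xi_2}U^1$. 2. Writing $U=\nabla\psi+W$ with $\mathrm{div}\,W=0$ (Hodge–Helmholtz decomposition), there exists a scalar function $F$ such that $$\nabla F=-\omega U^{\perp}-W .$$ Moreover, $c^2$ is given by $$c^2(U)=(\gamma-1)\left(F-\psi-\tfrac12|U|^2\right)\quad\text{if }\gamma\neq1,\qquad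 c^2=a^2\quad\text{if }\gamma=1,$$ and the Bernoulli type equation $$h+\psi+\tfrac12|U|^2=F$$ holds.
   Context: All derivatives of $U,\psi,W,F,\omega$ are with respect to the self-similar variables $\xi=(\xi_1,\xi_2)\in\mathbb R^2$. Superscripts denote vector components, $U=(U^1,U^2)$; $U^\perp=(-U^2,U^1)$; $DU$ is the Jacobian matrix $(DU)_{ij}=\partial_{\xi_j}U^i$. The functions involved are assumed sufficiently regular for the equations to hold classically, and $\rho>0$. The enthalpy is defined by $h'(\rho)=p'(\rho)/\rho$; for $\gamma\ne 1$ it is normalized as $h(\rho)=\dfrac{a^2\rho^{\gamma-1}}{\gamma-1}$. The function $F$ is determined by its gradient up to an additive constant $C$, which is absorbed in $F$ (normalized so that $C=0$). The assertion $c^2=\mathcal F(U)$ means that for the given solution $c^2$ can be expressed through the vector field $U$ alone (as a field, not necessarily as a pointwise function of the value $U(\xi)$), instead of through $(\rho,U)$; the explicit form is the one in part 2. *)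

theory Defs
  imports "HOL-Analysis.Analysis"
begin

definition C2 :: "('a::real_normed_vector \<Rightarrow> 'b::real_normed_vector) \<Rightarrow> bool" where
  "C2 f \<longleftrightarrow> (\<exists>(f' :: 'a \<Rightarrow> 'a \<Rightarrow>\<^sub>L 'b) (f'' :: 'a \<Rightarrow> 'a \<Rightarrow>\<^sub>L ('a \<Rightarrow>\<^sub>L 'b)).
     (\<forall>x. (f has_derivative blinfun_apply (f' x)) (at x)) \<and>
     (\<forall>x. (f' has_derivative blinfun_apply (f'' x)) (at x)) \<and>
     continuous_on UNIV f'')"

definition partial_deriv :: "2 \<Rightarrow> (real^2 \<Rightarrow> real) \<Rightarrow> real^2 \<Rightarrow> real" where
  "partial_deriv i f x = frechet_derivative f (at x) (axis i 1)"

definition divergence :: "(real^2 \<Rightarrow> real^2) \<Rightarrow> real^2 \<Rightarrow> real" where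
  "divergence u x = (\<Sum>i\<in>UNIV. partial_deriv i (\<lambda>y. u y $ i) x)"

definition rot :: "(real^2 \<Rightarrow> real^2) \<Rightarrow> real^2 \<Rightarrow> real" where
  "rot u x = partial_deriv 1 (\<lambda>y. u y $ 2) x - partial_deriv 2 (\<lambda>y. u y $ 1) x"

definition perp :: "real^2 \<Rightarrow> real^2" where
  "perp u = vector [- (u $ 2), u $ 1]"

text \<open>
  Classical solutions on the half space t > 0, with pressure law p and conservative form of
  both equations; the i-th component of the divergence of \<open>\<rho> v \<otimes> v\<close> is the divergence of
  \<open>\<rho> v\<^sub>i v\<close>. Joint differentiability in (t, x) is what makes the partial derivatives meaningful.
\<close>
definition isentropic_euler ::
    "(real \<Rightarrow> real) \<Rightarrow> (real \<Rightarrow> real^2 \<Rightarrow> real) \<Rightarrow> (real \<Rightarrow> real^2 \<Rightarrow> real^2) \<Rightarrow> bool" where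
  "isentropic_euler p \<rho> v \<longleftrightarrow> (\<forall>t>0. \<forall>x.
     (\<lambda>(s, y). \<rho> s y) differentiable (at (t, x)) \<and>
     (\<lambda>(s, y). v s y) differentiable (at (t, x)) \<and>
     deriv (\<lambda>s. \<rho> s x) t + divergence (\<lambda>y. \<rho> t y *\<^sub>R v t y) x = 0 \<and>
     (\<forall>i. deriv (\<lambda>s. \<rho> s x * v s x $ i) t
        + divergence (\<lambda>y. (\<rho> t y * v t y $ i) *\<^sub>R v t y) x
        + partial_deriv i (\<lambda>y. p (\<rho> t y)) x = 0))"

text \<open>Here \<open>\<rho>\<close> and v are the profiles, as functions of \<open>\<xi> = x / t\<close>.\<close>
definition self_similar_euler ::
    "(real \<Rightarrow> real) \<Rightarrow> (real^2 \<Rightarrow> real) \<Rightarrow> (real^2 \<Rightarrow> real^2) \<Rightarrow> bool" where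
  "self_similar_euler p \<rho> v \<longleftrightarrow>
     isentropic_euler p (\<lambda>t x. \<rho> (x /\<^sub>R t)) (\<lambda>t x. v (x /\<^sub>R t))"

definition pressure :: "real \<Rightarrow> real \<Rightarrow> real \<Rightarrow> real \<Rightarrow> real" where
  "pressure a \<gamma> r0 r = a\<^sup>2 / \<gamma> * (r powr \<gamma> - r0 powr \<gamma>)"

text \<open>For \<open>\<gamma> = 1\<close> the enthalpy is any antiderivative of \<open>p'(r) / r\<close>, with no normalization.\<close>
definition is_enthalpy :: "real \<Rightarrow> real \<Rightarrow> real \<Rightarrow> (real \<Rightarrow> real) \<Rightarrow> bool" where
  "is_enthalpy a \<gamma> r0 h \<longleftrightarrow> (\<forall>r>r0.
     (h has_real_derivative deriv (pressure a \<gamma> r0) r / r) (at r) \<and>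
     (\<gamma> \<noteq> 1 \<longrightarrow> h r = a\<^sup>2 * r powr (\<gamma> - 1) / (\<gamma> - 1)))"

text \<open>The first conjunct says \<open>U = \<nabla>\<psi> + W\<close>.\<close>
definition hodge_decomposition ::
    "(real^2 \<Rightarrow> real^2) \<Rightarrow> (real^2 \<Rightarrow> real) \<Rightarrow> (real^2 \<Rightarrow> real^2) \<Rightarrow> bool" where
  "hodge_decomposition U \<psi> W \<longleftrightarrow> (\<forall>\<xi>.
     (GDERIV \<psi> \<xi> :> U \<xi> - W \<xi>) \<and> W differentiable (at \<xi>) \<and> divergence W \<xi> = 0)"

text \<open>
  A solution's squared sound speed is a functional of the vector field U only up to one integration
  constant: for \<open>U \<xi> = - \<xi>\<close> every constant density is a solution. In the theorem the functional
  \<open>\<F>\<close> is common to all solutions and takes this constant in the form of the value at 0.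
\<close>

end

theory Submission
  imports Defs
begin

text \<open>
  With \<open>v = U + \<xi>\<close> and self-similarity, conservation of mass becomes
  \<open>U \<bullet> \<nabla>\<rho> + \<rho> div U + 2\<rho> = 0\<close>, and subtracting it from the momentum equation leaves
  \<open>(DU) U + U + \<nabla>(h \<circ> \<rho>) = 0\<close>. The inner product with \<open>U\<close> gives the first equation of the system.
  Since \<open>(DU) U = \<nabla>(|U|\<^sup>2/2) + \<omega> U\<^sup>\<bottom>\<close>, the field \<open>\<omega> U\<^sup>\<bottom> + U\<close> is a gradient; its vanishing curl is
  the second equation, and \<open>F = h \<circ> \<rho> + \<psi> + |U|\<^sup>2/2\<close> is the required potential.
  Finally \<open>\<nabla>(c\<^sup>2) = (\<gamma> - 1) \<nabla>(h \<circ> \<rho>) = - (\<gamma> - 1) ((DU) U + U)\<close>, so \<open>U\<close> determines \<open>c\<^sup>2\<close> up to a constant.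
\<close>

section \<open>Symmetry of second derivatives\<close>

text \<open>The mean value theorem along \<open>u\<close> turns the second difference into
  \<open>s\<close> times an increment of \<open>f' _ u\<close>, and the derivative \<open>A\<close>
  of that map at \<open>x\<close> approximates the increment.\<close>

lemma second_difference_approx:
  fixes f :: "'a::real_normed_vector \<Rightarrow> real"
  assumes f: "\<And>y. (f has_derivative f' y) (at y)"
    and A: "((\<lambda>y. f' y u) has_derivative A) (at x)"
    and e: "e > 0"
  shows "\<exists>d>0. \<forall>s. 0 < s \<longrightarrow> s < d \<longrightarrow>
    \<bar>f (x + s *\<^sub>R u + s *\<^sub>R v) - f (x + s *\<^sub>R u) - f (x + s *\<^sub>R v) + f x - s\<^sup>2 * A v\<bar> \<le> e * s\<^sup>2"
proof -
  \<comment> \<open>\<open>K * s\<close> bounds the sum of the distances from \<open>x\<close> of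
    the two points where \<open>f'\<close> is evaluated; the summand 1 keeps \<open>K\<close>
    positive even if \<open>u = v = 0\<close>.\<close>
  define K where "K = 2 * (norm u + norm v) + 1"
  have K: "K > 0" by (simp add: K_def add_nonneg_pos)
  interpret A: bounded_linear A using A by (rule has_derivative_bounded_linear)
  obtain d where d: "d > 0"
    and approx: "\<And>y. norm (y - x) < d \<Longrightarrow> \<bar>f' y u - f' x u - A (y - x)\<bar> \<le> e / K * norm (y - x)"
    using A e K unfolding has_derivative_at_alt by (metis divide_pos_pos real_norm_def)
  show ?thesis
  proof (intro exI[of _ "d / K"] conjI allI impI)
    show "d / K > 0" using d K by simp
    fix s :: real assume s: "0 < s" "s < d / K"
    \<comment> \<open>The increment in direction \<open>v\<close> is regarded as a function of the
      position along \<open>u\<close>, so that \<open>g s - g 0\<close> is the second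
      difference.\<close>
    define g where "g t = f (x + t *\<^sub>R u + s *\<^sub>R v) - f (x + t *\<^sub>R u)" for t
    define g' where "g' t = f' (x + t *\<^sub>R u + s *\<^sub>R v) u - f' (x + t *\<^sub>R u) u" for t
    have line: "((\<lambda>t. f (z + t *\<^sub>R u)) has_real_derivative f' (z + t *\<^sub>R u) u) (at t)" for z t
    proof -
      have "((\<lambda>t. z + t *\<^sub>R u) has_derivative (\<lambda>t. t *\<^sub>R u)) (at t)"
        by (auto intro!: derivative_eq_intros)
      from has_derivative_compose[OF this f]
      have "((\<lambda>t. f (z + t *\<^sub>R u)) has_derivative (\<lambda>h. f' (z + t *\<^sub>R u) (h *\<^sub>R u))) (at t)" .
      moreover have "f' (z + t *\<^sub>R u) (h *\<^sub>R u) = f' (z + t *\<^sub>R u) u * h" for h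
        using linear_scale[OF has_derivative_linear[OF f[of "z + t *\<^sub>R u"]], of h u] by simp
      ultimately show ?thesis by (simp add: has_field_derivative_def)
    qed
    have "(g has_real_derivative g' t) (at t)" for t
      using DERIV_diff[OF line[of "x + s *\<^sub>R v" t] line[of x t]]
      unfolding g_def[abs_def] g'_def by (simp add: algebra_simps)
    then obtain t where t: "0 < t" "t < s" "g s - g 0 = s * g' t"
      using MVT2[of 0 s g g'] s by auto
    have size: "norm (t *\<^sub>R u) \<le> s * norm u" "norm (s *\<^sub>R v) = s * norm v"
      using t s by (simp_all add: mult_right_mono)
    have n: "norm (t *\<^sub>R u + s *\<^sub>R v) + norm (t *\<^sub>R u) \<le> K * s"
    proof -
      have "norm (t *\<^sub>R u + s *\<^sub>R v) + norm (t *\<^sub>R u) \<le> 2 * (s * norm u) + s * norm v"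
        using norm_triangle_ineq[of "t *\<^sub>R u" "s *\<^sub>R v"] size by linarith
      also have "\<dots> \<le> K * s" using s by (simp add: K_def algebra_simps)
      finally show ?thesis .
    qed
    have Ks: "K * s < d" using s K by (simp add: field_simps)
    have lt: "norm (t *\<^sub>R u + s *\<^sub>R v) < d" "norm (t *\<^sub>R u) < d"
      using n Ks norm_ge_zero[of "t *\<^sub>R u + s *\<^sub>R v"] norm_ge_zero[of "t *\<^sub>R u"] by linarith+
    have "\<bar>f' (x + t *\<^sub>R u + s *\<^sub>R v) u - f' x u - A (t *\<^sub>R u + s *\<^sub>R v)\<bar>
        \<le> e / K * norm (t *\<^sub>R u + s *\<^sub>R v)"
      using approx[of "x + t *\<^sub>R u + s *\<^sub>R v"] lt by (simp add: algebra_simps)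
    moreover have "\<bar>f' (x + t *\<^sub>R u) u - f' x u - A (t *\<^sub>R u)\<bar> \<le> e / K * norm (t *\<^sub>R u)"
      using approx[of "x + t *\<^sub>R u"] lt by simp
    \<comment> \<open>By linearity the unknown mean value point \<open>t\<close> drops out of the
      main term and survives only in the error.\<close>
    moreover have "A (t *\<^sub>R u + s *\<^sub>R v) - A (t *\<^sub>R u) = s * A v"
      by (simp add: A.add A.scaleR)
    ultimately have "\<bar>g' t - s * A v\<bar>
        \<le> e / K * norm (t *\<^sub>R u + s *\<^sub>R v) + e / K * norm (t *\<^sub>R u)"
      unfolding g'_def by linarith
    also have "\<dots> = e / K * (norm (t *\<^sub>R u + s *\<^sub>R v) + norm (t *\<^sub>R u))"
      by (simp add: distrib_left)
    also have "\<dots> \<le> e / K * (K * s)"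
      using n e K by (intro mult_left_mono) simp_all
    also have "\<dots> = e * s" using K by simp
    finally have "s * \<bar>g' t - s * A v\<bar> \<le> s * (e * s)"
      using s by (intro mult_left_mono) simp_all
    moreover have "s * \<bar>g' t - s * A v\<bar> = \<bar>g s - g 0 - s\<^sup>2 * A v\<bar>"
    proof -
      have "s * \<bar>g' t - s * A v\<bar> = \<bar>s * (g' t - s * A v)\<bar>" using s by (simp add: abs_mult)
      also have "s * (g' t - s * A v) = g s - g 0 - s\<^sup>2 * A v"
        unfolding t(3) by (simp add: power2_eq_square algebra_simps)
      finally show ?thesis .
    qed
    ultimately show "\<bar>f (x + s *\<^sub>R u + s *\<^sub>R v) - f (x + s *\<^sub>R u) - f (x + s *\<^sub>R v) + f x - s\<^sup>2 * A v\<bar>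
        \<le> e * s\<^sup>2"
      by (simp add: g_def power2_eq_square algebra_simps)
  qed
qed

text \<open>The second difference is symmetric in \<open>u\<close> and \<open>v\<close>; divided by
  \<open>s\<^sup>2\<close> it tends to \<open>A v\<close> and, with the roles exchanged, to
  \<open>B u\<close>.\<close>

lemma mixed_derivatives_commute:
  fixes f :: "'a::real_normed_vector \<Rightarrow> real"
  assumes f: "\<And>y. (f has_derivative f' y) (at y)"
    and A: "((\<lambda>y. f' y u) has_derivative A) (at x)"
    and B: "((\<lambda>y. f' y v) has_derivative B) (at x)"
  shows "A v = B u"
proof (rule ccontr)
  assume "A v \<noteq> B u"
  \<comment> \<open>With a third of the gap, the two errors add up to only two thirds of it, which
    is the contradiction.\<close>
  define e where "e = \<bar>A v - B u\<bar> / 3"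
  have e: "e > 0" using \<open>A v \<noteq> B u\<close> by (simp add: e_def)
  define \<Delta> where
    "\<Delta> s = f (x + s *\<^sub>R u + s *\<^sub>R v) - f (x + s *\<^sub>R u) - f (x + s *\<^sub>R v) + f x" for s
  obtain d1 where d1: "d1 > 0" "\<And>s. 0 < s \<Longrightarrow> s < d1 \<Longrightarrow> \<bar>\<Delta> s - s\<^sup>2 * A v\<bar> \<le> e * s\<^sup>2"
    using second_difference_approx[OF f A e, of v] unfolding \<Delta>_def by blast
  obtain d2 where d2: "d2 > 0" "\<And>s. 0 < s \<Longrightarrow> s < d2 \<Longrightarrow> \<bar>\<Delta> s - s\<^sup>2 * B u\<bar> \<le> e * s\<^sup>2"
    using second_difference_approx[OF f B e, of u] unfolding \<Delta>_def
    by (auto simp: algebra_simps)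
  define s where "s = min d1 d2 / 2"
  have s: "0 < s" "s < d1" "s < d2" using d1 d2 by (auto simp: s_def)
  have "s\<^sup>2 * \<bar>A v - B u\<bar> = \<bar>s\<^sup>2 * A v - s\<^sup>2 * B u\<bar>"
    by (simp add: abs_mult flip: right_diff_distrib)
  also have "\<dots> \<le> e * s\<^sup>2 + e * s\<^sup>2"
    using d1(2)[of s] d2(2)[of s] s by linarith
  also have "\<dots> < s\<^sup>2 * \<bar>A v - B u\<bar>"
    using s \<open>A v \<noteq> B u\<close> by (simp add: e_def field_simps)
  finally show False by simp
qed

section \<open>Partial derivatives\<close>

lemma partial_deriv_eq:
  assumes "(f has_derivative f') (at x)"
  shows "partial_deriv i f x = f' (axis i 1)"
  by (simp add: partial_deriv_def frechet_derivative_at[OF assms, symmetric])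

lemma gderiv_partial_deriv:
  assumes "GDERIV f x :> D"
  shows "partial_deriv i f x = D $ i"
  using partial_deriv_eq[OF assms[unfolded gderiv_def], of i] by (simp add: inner_axis')

lemma gderiv_imp_differentiable: "GDERIV f x :> D \<Longrightarrow> f differentiable (at x)"
  unfolding gderiv_def differentiable_def by blast

text \<open>Linearity and expansion in the standard basis. This gives access to the
  \<open>GDERIV\<close> calculus rules for \<open>partial_deriv\<close>.\<close>

lemma gderiv_partials:
  fixes f :: "real^2 \<Rightarrow> real"
  assumes "f differentiable (at x)"
  shows "GDERIV f x :> (\<chi> i. partial_deriv i f x)"
proof -
  obtain f' where f': "(f has_derivative f') (at x)"
    using assms unfolding differentiable_def by blast
  have "f' h = h \<bullet> (\<chi> i. f' (axis i 1))" for h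
  proof -
    have "f' h = f' (\<Sum>i\<in>UNIV. h $ i *\<^sub>R axis i 1)"
      using basis_expansion[of h] by (simp add: scalar_mult_eq_scaleR)
    also have "\<dots> = (\<Sum>i\<in>UNIV. h $ i *\<^sub>R f' (axis i 1))"
      by (simp add: linear_sum linear_scale has_derivative_linear[OF f'])
    finally show ?thesis by (simp add: inner_vec_def)
  qed
  then have "f' = (\<lambda>h. h \<bullet> (\<chi> i. partial_deriv i f x))"
    unfolding partial_deriv_eq[OF f'] by (rule ext)
  then show ?thesis using f' unfolding gderiv_def by metis
qed

lemma gderiv_iff_partial_deriv:
  "(GDERIV f x :> D) \<longleftrightarrow> f differentiable (at x) \<and> (\<forall>i. partial_deriv i f x = D $ i)"
proof
  assume "f differentiable (at x) \<and> (\<forall>i. partial_deriv i f x = D $ i)"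
  then show "GDERIV f x :> D" using gderiv_partials[of f x] by simp
qed (auto simp: gderiv_partial_deriv gderiv_imp_differentiable)

text \<open>The difference has zero derivative on the whole plane. This yields both the uniqueness
  of \<open>F\<close> and the determination of the squared sound speed by its value at 0.\<close>

lemma gderiv_unique_up_to_constant:
  assumes "\<And>\<xi>. GDERIV f \<xi> :> D \<xi>" and "\<And>\<xi>. GDERIV g \<xi> :> D \<xi>"
  shows "\<exists>C. \<forall>\<xi>. f \<xi> = g \<xi> + C"
proof -
  have "((\<lambda>\<xi>. f \<xi> - g \<xi>) has_derivative (\<lambda>h. 0)) (at \<xi>)" for \<xi>
    using GDERIV_diff[OF assms(1)[of \<xi>] assms(2)[of \<xi>]] by (simp add: gderiv_def)
  then obtain C where "\<forall>\<xi>\<in>UNIV. f \<xi> - g \<xi> = C"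
    using has_derivative_zero_constant[of UNIV "\<lambda>\<xi>. f \<xi> - g \<xi>"] by auto
  then show ?thesis by (intro exI[of _ C]) (simp add: algebra_simps)
qed

lemma partial_deriv_mult:
  assumes "f differentiable (at x)" "g differentiable (at x)"
  shows "partial_deriv i (\<lambda>y. f y * g y) x = f x * partial_deriv i g x + g x * partial_deriv i f x"
  using gderiv_partial_deriv[where i = i, OF GDERIV_mult[OF gderiv_partials[OF assms(1)] gderiv_partials[OF assms(2)]]]
  by simp

lemma partial_deriv_compose:
  assumes "f differentiable (at x)" "(g has_real_derivative d) (at (f x))"
  shows "partial_deriv i (\<lambda>y. g (f y)) x = d * partial_deriv i f x"
  using gderiv_partial_deriv[where i = i, OF GDERIV_DERIV_compose[OF gderiv_partials[OF assms(1)] assms(2)]]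
  by simp

lemma differentiable_component:
  fixes u :: "'a::real_normed_vector \<Rightarrow> real^'n"
  assumes "u differentiable (at x)"
  shows "(\<lambda>y. u y $ j) differentiable (at x)"
  using assms bounded_linear.has_derivative[OF bounded_linear_vec_nth]
  unfolding differentiable_def by blast

lemma divergence_scaleR:
  assumes "f differentiable (at x)" "u differentiable (at x)"
  shows "divergence (\<lambda>y. f y *\<^sub>R u y) x
    = f x * divergence u x + (\<Sum>i\<in>UNIV. u x $ i * partial_deriv i f x)"
  by (simp add: divergence_def partial_deriv_mult[OF assms(1) differentiable_component[OF assms(2)]]
      sum.distrib sum_distrib_left)

text \<open>Links the matrix \<open>jacobian\<close> to \<open>partial_deriv\<close>, so that
  identities involving \<open>(DU) U\<close> can be checked componentwise.\<close>

lemma jacobian_vector_mult_component: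
  assumes "u differentiable (at x)"
  shows "(jacobian u (at x) *v w) $ i = (\<Sum>j\<in>UNIV. w $ j * partial_deriv j (\<lambda>y. u y $ i) x)"
proof -
  let ?D = "frechet_derivative u (at x)"
  have D: "(u has_derivative ?D) (at x)" using assms frechet_derivative_works by blast
  have "((\<lambda>y. u y $ i) has_derivative (\<lambda>h. ?D h $ i)) (at x)"
    using bounded_linear.has_derivative[OF bounded_linear_vec_nth D] .
  from partial_deriv_eq[OF this] show ?thesis
    by (simp add: jacobian_def matrix_def matrix_vector_mult_def mult.commute)
qed

section \<open>Self-similar fields at time 1\<close>

text \<open>Chain rule: at \<open>s = 1\<close> the point \<open>x /\<^sub>R s\<close> moves with
  velocity \<open>- x\<close>. Time 1 suffices, because there \<open>x\<close> itself is the
  self-similar variable.\<close>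

lemma deriv_self_similar:
  fixes g :: "real^2 \<Rightarrow> real"
  assumes "g differentiable (at x)"
  shows "deriv (\<lambda>s. g (x /\<^sub>R s)) 1 = - (\<Sum>i\<in>UNIV. x $ i * partial_deriv i g x)"
proof -
  have "((\<lambda>s. x /\<^sub>R s) has_derivative (\<lambda>h. - h *\<^sub>R x)) (at 1)"
    by (auto intro!: derivative_eq_intros)
  moreover have "(g has_derivative (\<lambda>h. h \<bullet> (\<chi> i. partial_deriv i g x))) (at (x /\<^sub>R 1))"
    using gderiv_partials[OF assms] by (simp add: gderiv_def)
  ultimately have "((\<lambda>s. g (x /\<^sub>R s)) has_derivative (\<lambda>h. (- h *\<^sub>R x) \<bullet> (\<chi> i. partial_deriv i g x))) (at 1)"
    by (rule has_derivative_compose)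
  moreover have "(\<lambda>h. (- h *\<^sub>R x) \<bullet> (\<chi> i. partial_deriv i g x))
      = (*) (- (\<Sum>i\<in>UNIV. x $ i * partial_deriv i g x))"
    by (simp add: fun_eq_iff inner_vec_def sum_2 algebra_simps)
  ultimately have "((\<lambda>s. g (x /\<^sub>R s)) has_real_derivative - (\<Sum>i\<in>UNIV. x $ i * partial_deriv i g x)) (at 1)"
    by (simp add: has_field_derivative_def)
  then show ?thesis by (rule DERIV_imp_deriv)
qed

text \<open>The profiles are the restrictions of the space-time fields to the slice
  \<open>t = 1\<close>, parametrized by \<open>y\<close> through \<open>(1, y)\<close>.\<close>

lemma self_similar_euler_differentiable:
  assumes "self_similar_euler p \<rho> v"
  shows "\<rho> differentiable (at x)" and "v differentiable (at x)"
proof -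
  have slice: "g differentiable (at x)"
    if g: "(\<lambda>(s, y). g (y /\<^sub>R s)) differentiable (at (1, x))"
    for g :: "real^2 \<Rightarrow> 'b::real_normed_vector"
  proof -
    obtain g' where "((\<lambda>(s, y). g (y /\<^sub>R s)) has_derivative g') (at (1, x))"
      using g unfolding differentiable_def by blast
    moreover have "((\<lambda>y. (1::real, y)) has_derivative (\<lambda>h. (0, h))) (at x)"
      by (auto intro!: derivative_eq_intros)
    ultimately show ?thesis
      using has_derivative_compose[of "\<lambda>y. (1, y)" _ x UNIV "\<lambda>(s, y). g (y /\<^sub>R s)"]
      unfolding differentiable_def by fastforce
  qed
  show "\<rho> differentiable (at x)" "v differentiable (at x)"
    using assms unfolding self_similar_euler_def isentropic_euler_def
    by (auto intro!: slice)
qed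

lemma pressure_deriv:
  assumes "r > 0" "\<gamma> \<noteq> 0"
  shows "(pressure a \<gamma> r0 has_real_derivative a\<^sup>2 * r powr (\<gamma> - 1)) (at r)"
  unfolding pressure_def[abs_def] using assms
  by (auto intro!: derivative_eq_intros)

section \<open>The self-similar system\<close>

text \<open>At time 1 the time derivative contributes the transport term with velocity
  \<open>- x\<close>, which combines with transport by \<open>v\<close> into transport by the
  pseudo-velocity.\<close>

lemma self_similar_mass:
  assumes E: "self_similar_euler p \<rho> v"
  shows "(\<Sum>i\<in>UNIV. (v x - x) $ i * partial_deriv i \<rho> x) + \<rho> x * divergence v x = 0"
proof -
  note d = self_similar_euler_differentiable[OF E]
  have "deriv (\<lambda>s. \<rho> (x /\<^sub>R s)) 1 + divergence (\<lambda>y. \<rho> y *\<^sub>R v y) x = 0"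
    using E[unfolded self_similar_euler_def isentropic_euler_def, THEN spec, of 1] by simp
  then show ?thesis
    by (simp add: deriv_self_similar d divergence_scaleR sum_2 algebra_simps)
qed

lemma self_similar_momentum:
  assumes E: "self_similar_euler p \<rho> v" and p: "(p has_real_derivative c) (at (\<rho> x))"
  shows "\<rho> x * (\<Sum>j\<in>UNIV. (v x - x) $ j * partial_deriv j (\<lambda>y. v y $ i) x)
    + c * partial_deriv i \<rho> x = 0"
proof -
  note d = self_similar_euler_differentiable[OF E]
  note dv = differentiable_component[OF d(2)]
  have dm: "(\<lambda>y. \<rho> y * v y $ i) differentiable (at x)"
    using d(1) dv by (rule differentiable_mult)
  have "deriv (\<lambda>s. \<rho> (x /\<^sub>R s) * v (x /\<^sub>R s) $ i) 1
      + divergence (\<lambda>y. (\<rho> y * v y $ i) *\<^sub>R v y) x + partial_deriv i (\<lambda>y. p (\<rho> y)) x = 0"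
    using E[unfolded self_similar_euler_def isentropic_euler_def, THEN spec, of 1] by simp
  moreover have "deriv (\<lambda>s. \<rho> (x /\<^sub>R s) * v (x /\<^sub>R s) $ i) 1
      = - (\<Sum>j\<in>UNIV. x $ j * partial_deriv j (\<lambda>y. \<rho> y * v y $ i) x)"
    using deriv_self_similar[OF dm] .
  \<comment> \<open>The conservative equation splits into \<open>v x $ i\<close> times the mass
    equation, which vanishes, plus the nonconservative momentum equation.\<close>
  ultimately have "v x $ i * ((\<Sum>j\<in>UNIV. (v x - x) $ j * partial_deriv j \<rho> x) + \<rho> x * divergence v x)
      + (\<rho> x * (\<Sum>j\<in>UNIV. (v x - x) $ j * partial_deriv j (\<lambda>y. v y $ i) x)
        + c * partial_deriv i \<rho> x) = 0"
    by (simp add: divergence_scaleR[OF dm d(2)] partial_deriv_mult[OF d(1) dv]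
        partial_deriv_compose[where g = p, OF d(1) p] sum_2 algebra_simps)
  then show ?thesis unfolding self_similar_mass[OF E] by simp
qed

text \<open>The correction is the Jacobian of the identity; it is the source of the 2 added to
  \<open>divergence U\<close> and of the extra term \<open>U\<close> in the momentum
  balance.\<close>

lemma partial_deriv_pseudo_velocity:
  fixes v :: "real^2 \<Rightarrow> real^2"
  assumes "v differentiable (at x)"
  shows "partial_deriv j (\<lambda>y. (v y - y) $ i) x
    = partial_deriv j (\<lambda>y. v y $ i) x - (if i = j then 1 else 0)"
proof -
  have "((\<lambda>y. (v y - y) $ i) has_derivative
      (\<lambda>h. h \<bullet> (\<chi> j. partial_deriv j (\<lambda>y. v y $ i) x) - h $ i)) (at x)"
    using gderiv_partials[OF differentiable_component[OF assms]]
    by (auto simp: gderiv_def intro!: derivative_eq_intros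
        bounded_linear.has_derivative[OF bounded_linear_vec_nth])
  from partial_deriv_eq[OF this] show ?thesis
    by (simp add: inner_axis') (simp add: axis_def)
qed

lemma pseudo_velocity_mass:
  assumes E: "self_similar_euler p \<rho> v" and U: "U = (\<lambda>\<xi>. v \<xi> - \<xi>)"
  shows "(\<Sum>i\<in>UNIV. U x $ i * partial_deriv i \<rho> x) + \<rho> x * (divergence U x + 2) = 0"
proof -
  have "divergence v x = divergence U x + 2"
    using partial_deriv_pseudo_velocity[OF self_similar_euler_differentiable(2)[OF E]]
    by (simp add: U divergence_def sum_2)
  then show ?thesis using self_similar_mass[OF E, of x] by (simp add: U)
qed

text \<open>Momentum balance solved for the density gradient. For \<open>c = p'(\<rho>)\<close> the
  factor \<open>\<rho> x / c\<close> is the reciprocal of the enthalpy derivative, so it cancels on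
  passing to the gradient of the enthalpy.\<close>

lemma pseudo_velocity_momentum:
  assumes E: "self_similar_euler p \<rho> v" and U: "U = (\<lambda>\<xi>. v \<xi> - \<xi>)"
    and p: "(p has_real_derivative c) (at (\<rho> x))" and c: "c \<noteq> 0"
  shows "GDERIV \<rho> x :> (\<rho> x / c) *\<^sub>R (- (jacobian U (at x) *v U x) - U x)"
proof -
  note d = self_similar_euler_differentiable[OF E]
  have dU: "U differentiable (at x)" unfolding U using d(2) by (intro derivative_intros) auto
  have v: "partial_deriv j (\<lambda>y. v y $ k) x
      = partial_deriv j (\<lambda>y. U y $ k) x + (if k = j then 1 else 0)" for j k
    using partial_deriv_pseudo_velocity[OF d(2), of j k] by (simp add: U)
  have "partial_deriv i \<rho> x = \<rho> x / c * (- (jacobian U (at x) *v U x) $ i - U x $ i)" for i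
  proof -
    have "\<rho> x * (\<Sum>j\<in>UNIV. U x $ j * partial_deriv j (\<lambda>y. v y $ i) x) + c * partial_deriv i \<rho> x = 0"
      using self_similar_momentum[OF E p, of i] by (simp add: U)
    then show ?thesis
      \<comment> \<open>Fixing the index lets the Kronecker delta be evaluated, which produces the
        term \<open>U x $ i\<close>.\<close>
      using c exhaust_2[of i]
      by (auto simp: v jacobian_vector_mult_component[OF dU] sum_2 field_simps)
  qed
  then show ?thesis
    using d(1)[of x] by (simp add: gderiv_iff_partial_deriv)
qed

section \<open>Kinetic energy and vorticity\<close>

text \<open>The gradient is the transposed Jacobian applied to \<open>U\<close>; in the plane the
  antisymmetric part of the Jacobian is determined by \<open>rot U\<close>, whence the correction by
  \<open>perp\<close>.\<close>

lemma gderiv_kinetic_energy: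
  fixes U :: "real^2 \<Rightarrow> real^2"
  assumes d: "U differentiable (at x)"
  shows "GDERIV (\<lambda>y. (norm (U y))\<^sup>2 / 2) x :> jacobian U (at x) *v U x - rot U x *\<^sub>R perp (U x)"
proof -
  note g = gderiv_partials[OF differentiable_component[OF d]]
  have e: "(\<lambda>y. (norm (U y))\<^sup>2 / 2) = (\<lambda>y. ((U y $ 1) * (U y $ 1) + U y $ 2 * U y $ 2) * (1/2))"
    unfolding power2_norm_eq_inner inner_vec_def by (simp add: sum_2)
  have "GDERIV (\<lambda>y. ((U y $ 1) * (U y $ 1) + U y $ 2 * U y $ 2) * (1/2)) x
     :> jacobian U (at x) *v U x - rot U x *\<^sub>R perp (U x)"
    by (rule GDERIV_subst[OF GDERIV_mult[OF GDERIV_add[OF GDERIV_mult[OF g g] GDERIV_mult[OF g g]] GDERIV_const]])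
      (auto simp: vec_eq_iff forall_2 jacobian_vector_mult_component[OF d] sum_2 rot_def perp_def
         algebra_simps)
  then show ?thesis by (simp only: e)
qed

lemma C2_imp_differentiable:
  assumes "C2 f"
  shows "f differentiable (at x)"
  using assms unfolding C2_def differentiable_def by blast

text \<open>\<open>rot U\<close> is a difference of entries of the first derivative, which is itself
  differentiable. The vorticity equation needs this for the divergence of
  \<open>\<omega> U\<close>.\<close>

lemma C2_imp_rot_differentiable:
  assumes "C2 U"
  shows "rot U differentiable (at x)"
proof -
  obtain f' f'' where f': "\<And>x. (U has_derivative blinfun_apply (f' x)) (at x)"
    and f'': "\<And>x. (f' has_derivative blinfun_apply (f'' x)) (at x)"
    using assms unfolding C2_def by blast
  have "partial_deriv i (\<lambda>y. U y $ j) x = f' x (axis i 1) $ j" for i j x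
    using partial_deriv_eq[OF bounded_linear.has_derivative[OF bounded_linear_vec_nth f']] .
  then have e: "rot U = (\<lambda>x. f' x (axis 1 1) $ 2 - f' x (axis 2 1) $ 1)"
    by (simp add: rot_def[abs_def])
  have "(\<lambda>x. f' x w $ j) differentiable (at x)" for w j
    using bounded_linear.has_derivative[OF bounded_linear_vec_nth
        bounded_linear.has_derivative[OF bounded_linear_apply_blinfun f'']]
    unfolding differentiable_def by blast
  then show ?thesis unfolding e by (intro differentiable_diff)
qed

text \<open>A gradient field has zero curl: the second partial derivative of
  \<open>\<omega> U\<^sub>2 - U\<^sub>1\<close> equals the first partial derivative of
  \<open>- \<omega> U\<^sub>1 - U\<^sub>2\<close>.\<close>

lemma vorticity_equation:
  fixes U :: "real^2 \<Rightarrow> real^2"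
  assumes U: "U differentiable (at x)" and \<omega>: "rot U differentiable (at x)"
    and g: "\<And>y. GDERIV g y :> - (rot U y *\<^sub>R perp (U y)) - U y"
  shows "divergence (\<lambda>y. rot U y *\<^sub>R U y) x + rot U x = 0"
proof -
  note gU = gderiv_partials[OF differentiable_component[OF U]]
  note g\<omega> = gderiv_partials[OF \<omega>]
  have g': "(g has_derivative (\<lambda>h. h \<bullet> (- (rot U y *\<^sub>R perp (U y)) - U y))) (at y)" for y
    using g[of y] by (simp add: gderiv_def)
  have 1: "GDERIV (\<lambda>y. axis 1 1 \<bullet> (- (rot U y *\<^sub>R perp (U y)) - U y)) x :> 
    ((rot U x *\<^sub>R (\<chi> i. partial_deriv i (\<lambda>y. U y $ 2) x) + U x $ 2 *\<^sub>R (\<chi> i. partial_deriv i (rot U) x))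
      - (\<chi> i. partial_deriv i (\<lambda>y. U y $ 1) x))"
    using GDERIV_diff[OF GDERIV_mult[OF g\<omega> gU[of 2]] gU[of 1]]
    by (simp add: inner_axis' perp_def)
  have 2: "GDERIV (\<lambda>y. axis 2 1 \<bullet> (- (rot U y *\<^sub>R perp (U y)) - U y)) x :> 
    (- (rot U x *\<^sub>R (\<chi> i. partial_deriv i (\<lambda>y. U y $ 1) x) + U x $ 1 *\<^sub>R (\<chi> i. partial_deriv i (rot U) x))
      - (\<chi> i. partial_deriv i (\<lambda>y. U y $ 2) x))"
    using GDERIV_diff[OF GDERIV_minus[OF GDERIV_mult[OF g\<omega> gU[of 1]]] gU[of 2]]
    by (simp add: inner_axis' perp_def)
  from mixed_derivatives_commute[OF g' 1[unfolded gderiv_def] 2[unfolded gderiv_def]]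
  show ?thesis
    by (simp add: inner_axis' divergence_scaleR[OF \<omega> U] sum_2)
      (simp add: divergence_def rot_def sum_2 algebra_simps)
qed

section \<open>Recovery of the squared sound speed from the pseudo-velocity\<close>

text \<open>
  The functional \<open>\<F>\<close> of the theorem: \<open>U\<close> prescribes the gradient of \<open>c\<^sup>2\<close>, and \<open>k\<close> is the value at 0.
\<close>
definition sound_speed_functional :: "real \<Rightarrow> real \<Rightarrow> (real^2 \<Rightarrow> real^2) \<Rightarrow> real^2 \<Rightarrow> real" where
  "sound_speed_functional \<gamma> k U = (THE g. g 0 = k \<and>
     (\<forall>\<xi>. GDERIV g \<xi> :> (\<gamma> - 1) *\<^sub>R (- (jacobian U (at \<xi>) *v U \<xi>) - U \<xi>)))"

text \<open>Two functions with the prescribed gradient differ by a constant, and equal values at 0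
  make it zero; hence the definite description is met by \<open>g\<close> alone.\<close>

lemma sound_speed_functional_eq:
  assumes g: "\<And>\<xi>. GDERIV g \<xi> :> (\<gamma> - 1) *\<^sub>R (- (jacobian U (at \<xi>) *v U \<xi>) - U \<xi>)"
  shows "sound_speed_functional \<gamma> (g 0) U = g"
  unfolding sound_speed_functional_def
proof (rule the_equality)
  fix f
  assume f: "f 0 = g 0 \<and> (\<forall>\<xi>. GDERIV f \<xi> :> (\<gamma> - 1) *\<^sub>R (- (jacobian U (at \<xi>) *v U \<xi>) - U \<xi>))"
  then obtain C where C: "\<And>\<xi>. f \<xi> = g \<xi> + C"
    using gderiv_unique_up_to_constant[of f _ g, OF _ g] by blast
  then have "C = 0" using f C[of 0] by simp
  then show "f = g" using C by auto
qed (use g in simp)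

theorem theorem2p14:
  fixes a \<gamma> r0 :: real
  assumes "a > 0" and "\<gamma> \<ge> -1" and "\<gamma> \<noteq> 0" and "r0 \<ge> 0" and "\<gamma> < 1 \<Longrightarrow> r0 > 0"
  shows "\<exists>\<F> :: real \<Rightarrow> (real^2 \<Rightarrow> real^2) \<Rightarrow> (real^2 \<Rightarrow> real).
    \<forall>(\<rho> :: real^2 \<Rightarrow> real) (v :: real^2 \<Rightarrow> real^2) (h :: real \<Rightarrow> real)
      (U :: real^2 \<Rightarrow> real^2) (\<omega> :: real^2 \<Rightarrow> real) (c2 :: real^2 \<Rightarrow> real).
      (\<forall>\<xi>. \<rho> \<xi> > r0) \<longrightarrow>
      self_similar_euler (pressure a \<gamma> r0) \<rho> v \<longrightarrow>
      U = (\<lambda>\<xi>. v \<xi> - \<xi>) \<longrightarrow> C2 U \<longrightarrow>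
      \<omega> = rot U \<longrightarrow>
      c2 = (\<lambda>\<xi>. deriv (pressure a \<gamma> r0) (\<rho> \<xi>)) \<longrightarrow>
      is_enthalpy a \<gamma> r0 h \<longrightarrow>
        c2 = \<F> (c2 0) U \<and>
        (\<forall>\<xi>. c2 \<xi> * divergence U \<xi> - (jacobian U (at \<xi>) *v U \<xi>) \<bullet> U \<xi>
               = (norm (U \<xi>))\<^sup>2 - 2 * c2 \<xi>) \<and>
        (\<forall>\<xi>. divergence (\<lambda>\<eta>. \<omega> \<eta> *\<^sub>R U \<eta>) \<xi> + \<omega> \<xi> = 0) \<and>
        (\<forall>\<psi> W. hodge_decomposition U \<psi> W \<longrightarrow>
          (\<exists>F :: real^2 \<Rightarrow> real.
             (\<forall>\<xi>. GDERIV F \<xi> :> - (\<omega> \<xi> *\<^sub>R perp (U \<xi>)) - W \<xi>) \<and>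
             (\<forall>G. (\<forall>\<xi>. GDERIV G \<xi> :> - (\<omega> \<xi> *\<^sub>R perp (U \<xi>)) - W \<xi>) \<longrightarrow>
                (\<exists>C. \<forall>\<xi>. F \<xi> = G \<xi> + C)) \<and>
             (\<forall>\<xi>. c2 \<xi> = (if \<gamma> \<noteq> 1
                then (\<gamma> - 1) * (F \<xi> - \<psi> \<xi> - (norm (U \<xi>))\<^sup>2 / 2) else a\<^sup>2)) \<and>
             (\<forall>\<xi>. h (\<rho> \<xi>) + \<psi> \<xi> + (norm (U \<xi>))\<^sup>2 / 2 = F \<xi>)))"
\<comment> \<open>The witness depends on \<gamma> only; a solution enters through \<open>U\<close>
  and the number \<open>c2 0\<close>.\<close>
proof (intro exI[of _ "sound_speed_functional \<gamma>"] allI impI, goal_cases)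
  case (1 \<rho> v h U \<omega> c2)
  note E = 1(2) and U = 1(3)
  have pos: "\<rho> \<xi> > 0" for \<xi> using 1(1) assms(4) by (meson le_less_trans)
  have dp: "(pressure a \<gamma> r0 has_real_derivative a\<^sup>2 * r powr (\<gamma> - 1)) (at r)" if "r > 0" for r
    using pressure_deriv[OF that assms(3)] .
  have c2: "c2 = (\<lambda>\<xi>. a\<^sup>2 * \<rho> \<xi> powr (\<gamma> - 1))"
    unfolding 1(6) using DERIV_imp_deriv[OF dp[OF pos]] by auto
  have c2pos: "c2 \<xi> > 0" for \<xi> using assms(1) pos[of \<xi>] by (simp add: c2)
  have dU: "U differentiable (at \<xi>)" for \<xi> using C2_imp_differentiable[OF 1(4)] .
  have dp\<rho>: "(pressure a \<gamma> r0 has_real_derivative c2 \<xi>) (at (\<rho> \<xi>))" for \<xi>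
    using dp[OF pos] by (simp add: c2)
  let ?G = "\<lambda>\<xi>. - (jacobian U (at \<xi>) *v U \<xi>) - U \<xi>"
  have g\<rho>: "GDERIV \<rho> \<xi> :> (\<rho> \<xi> / c2 \<xi>) *\<^sub>R ?G \<xi>" for \<xi>
    using pseudo_velocity_momentum[OF E U dp\<rho>] c2pos[of \<xi>] by simp
  have "deriv (pressure a \<gamma> r0) (\<rho> \<xi>) = c2 \<xi>" for \<xi> by (simp add: 1(6))
  then have h: "(h has_real_derivative c2 \<xi> / \<rho> \<xi>) (at (\<rho> \<xi>))"
    "\<gamma> \<noteq> 1 \<Longrightarrow> c2 \<xi> = (\<gamma> - 1) * h (\<rho> \<xi>)" for \<xi>
    using 1(1,7) unfolding is_enthalpy_def by (metis, simp add: c2)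
  \<comment> \<open>The enthalpy derivative \<open>c2 \<xi> / \<rho> \<xi>\<close> cancels the
    factor in the density gradient.\<close>
  have gh: "GDERIV (\<lambda>\<xi>. h (\<rho> \<xi>)) \<xi> :> ?G \<xi>" for \<xi>
    by (rule GDERIV_subst[OF GDERIV_DERIV_compose[OF g\<rho> h(1)]])
      (use pos[of \<xi>] c2pos[of \<xi>] in simp)
  \<comment> \<open>Differentiating the power law directly, rather than using \<open>h(2)\<close>,
    also covers \<gamma> = 1, where the gradient is zero.\<close>
  have gc: "GDERIV c2 \<xi> :> (\<gamma> - 1) *\<^sub>R ?G \<xi>" for \<xi>
  proof -
    have "((\<lambda>r. a\<^sup>2 * r powr (\<gamma> - 1)) has_real_derivative (\<gamma> - 1) * (c2 \<xi> / \<rho> \<xi>)) (at (\<rho> \<xi>))"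
      using DERIV_cmult[OF has_real_derivative_powr[OF pos], of "a\<^sup>2" "\<gamma> - 1" \<xi>] pos[of \<xi>]
      by (simp add: c2 powr_diff power2_eq_square field_simps)
    from GDERIV_DERIV_compose[OF g\<rho> this] show ?thesis
      using pos[of \<xi>] c2pos[of \<xi>] by (simp flip: c2)
  qed
  \<comment> \<open>The terms \<open>(DU) U\<close> cancel. This potential serves the vorticity
    equation and, once \<psi> is added, becomes \<open>F\<close>.\<close>
  have gB: "GDERIV (\<lambda>y. h (\<rho> y) + (norm (U y))\<^sup>2 / 2) \<xi> :> - (\<omega> \<xi> *\<^sub>R perp (U \<xi>)) - U \<xi>" for \<xi>
    by (rule GDERIV_subst[OF GDERIV_add[OF gh gderiv_kinetic_energy[OF dU]]]) (simp add: 1(5))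
  show ?case
  proof (intro conjI allI impI)
    show "c2 = sound_speed_functional \<gamma> (c2 0) U" using sound_speed_functional_eq[OF gc] by simp
    show "c2 \<xi> * divergence U \<xi> - (jacobian U (at \<xi>) *v U \<xi>) \<bullet> U \<xi> = (norm (U \<xi>))\<^sup>2 - 2 * c2 \<xi>" for \<xi>
    proof -
      \<comment> \<open>The density gradient is inserted into the mass equation; the common factor
        \<open>\<rho> \<xi> / c2 \<xi>\<close> is then divided out.\<close>
      have "U \<xi> \<bullet> ((\<rho> \<xi> / c2 \<xi>) *\<^sub>R ?G \<xi>) + \<rho> \<xi> * (divergence U \<xi> + 2) = 0"
        using pseudo_velocity_mass[OF E U, of \<xi>]
        by (simp only: inner_vec_def gderiv_partial_deriv[OF g\<rho>] inner_real_def)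
      then have "\<rho> \<xi> / c2 \<xi> * (U \<xi> \<bullet> ?G \<xi> + c2 \<xi> * (divergence U \<xi> + 2)) = 0"
        unfolding inner_scaleR_right using c2pos[of \<xi>] by (simp add: distrib_left)
      then have "U \<xi> \<bullet> ?G \<xi> + c2 \<xi> * (divergence U \<xi> + 2) = 0"
        using c2pos[of \<xi>] pos[of \<xi>] by simp
      then show ?thesis
        by (simp add: inner_diff_right inner_commute power2_norm_eq_inner algebra_simps)
    qed
    show "divergence (\<lambda>\<eta>. \<omega> \<eta> *\<^sub>R U \<eta>) \<xi> + \<omega> \<xi> = 0" for \<xi>
      using vorticity_equation[OF dU C2_imp_rot_differentiable[OF 1(4)]] gB unfolding 1(5) by blast
  next
    fix \<psi> W assume H: "hodge_decomposition U \<psi> W"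
    \<comment> \<open>With this choice the Bernoulli equation holds by definition, with the additive
      constant already absorbed; adding the gradient \<open>U - W\<close> of \<psi> turns
      \<open>- U\<close> into \<open>- W\<close>.\<close>
    let ?F = "\<lambda>\<xi>. h (\<rho> \<xi>) + \<psi> \<xi> + (norm (U \<xi>))\<^sup>2 / 2"
    have gF: "GDERIV ?F \<xi> :> - (\<omega> \<xi> *\<^sub>R perp (U \<xi>)) - W \<xi>" for \<xi>
    proof -
      have "GDERIV \<psi> \<xi> :> U \<xi> - W \<xi>" using H unfolding hodge_decomposition_def by blast
      from GDERIV_add[OF gB this] show ?thesis by (simp add: add_ac minus_diff_commute)
    qed
    show "\<exists>F. (\<forall>\<xi>. GDERIV F \<xi> :> - (\<omega> \<xi> *\<^sub>R perp (U \<xi>)) - W \<xi>) \<and>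
      (\<forall>G. (\<forall>\<xi>. GDERIV G \<xi> :> - (\<omega> \<xi> *\<^sub>R perp (U \<xi>)) - W \<xi>) \<longrightarrow> (\<exists>C. \<forall>\<xi>. F \<xi> = G \<xi> + C)) \<and>
      (\<forall>\<xi>. c2 \<xi> = (if \<gamma> \<noteq> 1 then (\<gamma> - 1) * (F \<xi> - \<psi> \<xi> - (norm (U \<xi>))\<^sup>2 / 2) else a\<^sup>2)) \<and>
      (\<forall>\<xi>. h (\<rho> \<xi>) + \<psi> \<xi> + (norm (U \<xi>))\<^sup>2 / 2 = F \<xi>)"
    proof (intro exI[of _ ?F] conjI allI impI)
      show "\<exists>C. \<forall>\<xi>. ?F \<xi> = G \<xi> + C" if "\<forall>\<xi>. GDERIV G \<xi> :> - (\<omega> \<xi> *\<^sub>R perp (U \<xi>)) - W \<xi>" for G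
        using gderiv_unique_up_to_constant[OF gF] that by blast
      \<comment> \<open>For \<gamma> different from 1 the bracket is the normalized enthalpy; for
        \<gamma> = 1 the power of the positive density has exponent 0.\<close>
      show "c2 \<xi> = (if \<gamma> \<noteq> 1 then (\<gamma> - 1) * (?F \<xi> - \<psi> \<xi> - (norm (U \<xi>))\<^sup>2 / 2) else a\<^sup>2)" for \<xi>
        using h(2)[of \<xi>] pos[of \<xi>] by (simp add: c2)
    qed (use gF in simp_all)
  qed
qed

end
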